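(* Let $m$ and $F$ be positive integers such that $m\nmid F$ and $F>2m$, and let $S\in\mathscr{R}(F,m)$. Then $S$ is an $\mathrm{MR}$-semigroup if and only if one of the following statements is true: - $\mathrm{e}(S)=m-1$ and $\mathrm{msg}(S)\subseteq\{1,\ldots,F\}$; - $\mathrm{e}(S)=m$ and $\sharp\{x\in\mathrm{msg}(S)\mid x>F\}=1$.
   Context: A numerical semigroup is a submonoid $S$ of $(\mathbb{N},+)$ ($\mathbb{N}$ the nonnegative integers) with $\mathbb{N}\setminus S$ finite. Its Frobenius number $\mathrm{F}(S)$ is the largest integer not in $S$, its multiplicity is $\mathrm{m}(S)=\min(S\setminus\{0\})$, $\mathrm{msg}(S)$ is its unique minimal system of generators, and its embedding dimension $\mathrm{e}(S)$ is the cardinality of $\mathrm{msg}(S)$. For positive integers $m<F$ with $m\nmid F$, $\mathscr{R}(F,m)$ denotes the set of numerical semigroups $S$ with $\mathrm{F}(S)=F$ and $\mathrm{m}(S)=m$. It is closed under intersection and its minimum with respect to inclusion is $\Delta(F,m)=\langle m\rangle\cup\{n\in\mathbb{N}\mid n\ge F+1\}$, where $\langle m\rangle$ is the set of nonnegative multiples of $m$. A set $X$ is an $\mathscr{R}(F,m)$-set if $X\cap\Delta(F,m)=\emptyset$ and there is $S\in\mathscr{R}(F,m)$ with $X\subseteq S$. For such $X$, $\mathscr{R}(F,m)[X]$ denotes the intersection of all elements of $\mathscr{R}(F,m)$ containing $X$ (it is the smallest element of $\mathscr{R}(F,m)$ containing $X$). For $S\in\mathscr{R}(F,m)$, the $\mathscr{R}(F,m)$-rank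 of $S$ is $\mathscr{R}(F,m)\mathrm{rank}(S)=\min\{\sharp X\mid X\text{ is an }\mathscr{R}(F,m)\text{-set and }\mathscr{R}(F,m)[X]=S\}$, where $\sharp X$ is the cardinality of $X$. A numerical semigroup $S$ is an $\mathrm{MR}$-semigroup (has maximal rank) if $\mathrm{F}(S)>2\mathrm{m}(S)$ and $\mathscr{R}(\mathrm{F}(S),\mathrm{m}(S))\mathrm{rank}(S)=\mathrm{m}(S)-2$. *)

theory Defs
  imports Main "HOL.Hull"
begin

definition add_submonoid :: "nat set \<Rightarrow> bool" where
  "add_submonoid S \<longleftrightarrow> 0 \<in> S \<and> (\<forall>x\<in>S. \<forall>y\<in>S. x + y \<in> S)"

definition numerical_semigroup :: "nat set \<Rightarrow> bool" where
  "numerical_semigroup S \<longleftrightarrow> add_submonoid S \<and> finite (UNIV - S)"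

(* The greatest integer outside S, hence integer-valued: it is -1 for S = UNIV. *)
definition frobenius_number :: "nat set \<Rightarrow> int" where
  "frobenius_number S = (GREATEST z. z \<notin> int ` S)"

definition semigroup_multiplicity :: "nat set \<Rightarrow> nat" where
  "semigroup_multiplicity S = (LEAST x. x \<in> S - {0})"

definition minimal_generating_set :: "nat set \<Rightarrow> nat set \<Rightarrow> bool" where
  "minimal_generating_set S A \<longleftrightarrow>
     add_submonoid hull A = S \<and> (\<forall>B. B \<subset> A \<longrightarrow> add_submonoid hull B \<noteq> S)"

(* Well defined: see ex1_minimal_generating_set below. *)
definition msg :: "nat set \<Rightarrow> nat set" where
  "msg S = (THE A. minimal_generating_set S A)"

definition embedding_dimension :: "nat set \<Rightarrow> nat" where
  "embedding_dimension S = card (msg S)"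

definition RFm :: "nat \<Rightarrow> nat \<Rightarrow> nat set set" where
  "RFm F m = {S. numerical_semigroup S \<and> frobenius_number S = int F \<and>
                 semigroup_multiplicity S = m}"

definition Delta :: "nat \<Rightarrow> nat \<Rightarrow> nat set" where
  "Delta F m = {n. m dvd n} \<union> {n. n \<ge> F + 1}"

definition RFm_set :: "nat \<Rightarrow> nat \<Rightarrow> nat set \<Rightarrow> bool" where
  "RFm_set F m X \<longleftrightarrow> X \<inter> Delta F m = {} \<and> (\<exists>S\<in>RFm F m. X \<subseteq> S)"

definition RFm_generated :: "nat \<Rightarrow> nat \<Rightarrow> nat set \<Rightarrow> nat set" where
  "RFm_generated F m X = \<Inter> {T \<in> RFm F m. X \<subseteq> T}"

(* card is the true cardinality here: an RFm_set is disjoint from Delta F m, hence finite. *)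
definition RFm_rank :: "nat \<Rightarrow> nat \<Rightarrow> nat set \<Rightarrow> nat" where
  "RFm_rank F m S = (LEAST k. \<exists>X. RFm_set F m X \<and> RFm_generated F m X = S \<and> card X = k)"

(* The first two conjuncts make the Frobenius number positive, so that nat loses nothing. *)
definition MR_semigroup :: "nat set \<Rightarrow> bool" where
  "MR_semigroup S \<longleftrightarrow> numerical_semigroup S \<and>
     frobenius_number S > 2 * int (semigroup_multiplicity S) \<and>
     int (RFm_rank (nat (frobenius_number S)) (semigroup_multiplicity S) S)
       = int (semigroup_multiplicity S) - 2"

lemma add_submonoid_hull: "add_submonoid (add_submonoid hull A)"
  by (rule hull_in) (auto simp: add_submonoid_def)

lemma ex1_minimal_generating_set:
  assumes S: "add_submonoid S"
  shows "\<exists>!A. minimal_generating_set S A"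
proof -
  define M where
    "M = {x \<in> S. x \<noteq> 0 \<and> (\<forall>a\<in>S. \<forall>b\<in>S. a \<noteq> 0 \<longrightarrow> b \<noteq> 0 \<longrightarrow> x \<noteq> a + b)}"
  have zero: "0 \<in> add_submonoid hull M"
    and add: "\<And>a b. a \<in> add_submonoid hull M \<Longrightarrow> b \<in> add_submonoid hull M
               \<Longrightarrow> a + b \<in> add_submonoid hull M"
    using add_submonoid_hull[of M] by (auto simp: add_submonoid_def)
  have in_hull: "x \<in> add_submonoid hull M" if "x \<in> S" for x
    using that
  proof (induction x rule: less_induct)
    case (less x)
    show ?case
    proof (cases "x = 0 \<or> x \<in> M")
      case True
      then show ?thesis using zero hull_subset[of M add_submonoid] by blast
    next
      case False
      then obtain a b where "a \<in> S" "b \<in> S" "a \<noteq> 0" "b \<noteq> 0" "x = a + b"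
        using less.prems by (auto simp: M_def)
      then show ?thesis using less.IH[of a] less.IH[of b] add by simp
    qed
  qed
  have gen: "add_submonoid hull M = S"
    using in_hull hull_minimal[of M S add_submonoid] S by (auto simp: M_def)
  have sub: "M \<subseteq> B" if B: "add_submonoid hull B = S" for B
  proof
    fix x assume x: "x \<in> M"
    show "x \<in> B"
    proof (rule ccontr)
      assume "x \<notin> B"
      moreover have "B \<subseteq> S" using B hull_subset[of B add_submonoid] by simp
      ultimately have "B \<subseteq> S - {x}" by blast
      moreover have "add_submonoid (S - {x})"
        unfolding add_submonoid_def
      proof (intro conjI ballI)
        show "0 \<in> S - {x}" using S x by (auto simp: add_submonoid_def M_def)
        fix a b assume ab: "a \<in> S - {x}" "b \<in> S - {x}"
        then have "x \<noteq> a + b" using x by (cases "a = 0 \<or> b = 0") (auto simp: M_def)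
        then show "a + b \<in> S - {x}" using S ab by (auto simp: add_submonoid_def)
      qed
      ultimately have "S \<subseteq> S - {x}" using hull_minimal[of B _ add_submonoid] B by metis
      then show False using x by (auto simp: M_def)
    qed
  qed
  show ?thesis
    unfolding minimal_generating_set_def
  proof (rule ex1I[of _ M])
    show "add_submonoid hull M = S \<and> (\<forall>B. B \<subset> M \<longrightarrow> add_submonoid hull B \<noteq> S)"
      using gen sub by blast
  qed (use gen sub in blast)
qed

end

theory Submission
  imports Defs
begin

text \<open>
  The rank of a semigroup \<open>S\<close> in \<open>RFm F m\<close> counts its minimal generators outside
  \<open>Delta F m\<close>. Indeed the smallest member of \<open>RFm F m\<close> containing an admissible set \<open>X\<close>
  is the submonoid generated by \<open>X \<union> Delta F m\<close>, because \<open>Delta F m\<close> already forces the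
  prescribed multiplicity and Frobenius number (\<open>RFm_generated_eq_hull\<close>). A generating set of
  \<open>S\<close> must contain every atom of \<open>S\<close>, that is, every nonzero element that is not a sum of two
  nonzero elements, and the atoms suffice. So \<open>X\<close> yields \<open>S\<close> only if it contains the atoms
  outside \<open>Delta F m\<close>, and these alone yield \<open>S\<close> (\<open>RFm_rank_eq_card_atoms\<close>).

  The atoms inside \<open>Delta F m\<close> are \<open>m\<close> and those exceeding \<open>F\<close>. Hence the rank is \<open>m - 2\<close>
  exactly if \<open>m - 1\<close> atoms are at most \<open>F\<close>. Since distinct atoms are incongruent modulo \<open>m\<close>,
  there are at most \<open>m\<close> atoms altogether (\<open>card_atoms_le\<close>), which leaves room for at most one
  atom above \<open>F\<close>: none gives the first alternative and one gives the second.
\<close>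

section \<open>Atoms and minimal generators\<close>

definition atoms :: "nat set \<Rightarrow> nat set" where
  "atoms S = {x \<in> S. x \<noteq> 0 \<and> (\<forall>a\<in>S. \<forall>b\<in>S. a \<noteq> 0 \<longrightarrow> b \<noteq> 0 \<longrightarrow> x \<noteq> a + b)}"

lemma hull_atoms:
  assumes S: "add_submonoid S"
  shows "add_submonoid hull atoms S = S"
proof
  show "add_submonoid hull atoms S \<subseteq> S"
    using S by (intro hull_minimal) (auto simp: atoms_def)
next
  have zero: "0 \<in> add_submonoid hull atoms S"
    and add: "\<And>a b. a \<in> add_submonoid hull atoms S \<Longrightarrow> b \<in> add_submonoid hull atoms S
               \<Longrightarrow> a + b \<in> add_submonoid hull atoms S"
    using add_submonoid_hull[of "atoms S"] by (auto simp: add_submonoid_def)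
  show "S \<subseteq> add_submonoid hull atoms S"
  proof
    fix x assume "x \<in> S"
    then show "x \<in> add_submonoid hull atoms S"
    proof (induction x rule: less_induct)
      case (less x)
      show ?case
      proof (cases "x = 0 \<or> x \<in> atoms S")
        case True
        then show ?thesis using zero hull_subset[of "atoms S" add_submonoid] by blast
      next
        case False
        then obtain a b where "a \<in> S" "b \<in> S" "a \<noteq> 0" "b \<noteq> 0" "x = a + b"
          using less.prems by (auto simp: atoms_def)
        then show ?thesis using less.IH[of a] less.IH[of b] add by simp
      qed
    qed
  qed
qed

text \<open>An atom cannot be produced from the other elements: removing it leaves a submonoid.\<close>

lemma atoms_subset_generators:
  assumes B: "add_submonoid hull B = S"
  shows "atoms S \<subseteq> B"
proof
  fix x assume x: "x \<in> atoms S"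
  have S: "add_submonoid S" using B add_submonoid_hull by metis
  show "x \<in> B"
  proof (rule ccontr)
    assume "x \<notin> B"
    moreover have "B \<subseteq> S" using B hull_subset[of B add_submonoid] by simp
    ultimately have "B \<subseteq> S - {x}" by blast
    moreover have "add_submonoid (S - {x})"
      unfolding add_submonoid_def
    proof (intro conjI ballI)
      show "0 \<in> S - {x}" using S x by (auto simp: add_submonoid_def atoms_def)
      fix a b assume ab: "a \<in> S - {x}" "b \<in> S - {x}"
      then have "x \<noteq> a + b" using x by (cases "a = 0 \<or> b = 0") (auto simp: atoms_def)
      then show "a + b \<in> S - {x}" using S ab by (auto simp: add_submonoid_def)
    qed
    ultimately have "S \<subseteq> S - {x}" using hull_minimal[of B _ add_submonoid] B by metis
    then show False using x by (auto simp: atoms_def)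
  qed
qed

lemma msg_eq_atoms:
  assumes S: "add_submonoid S"
  shows "msg S = atoms S"
proof -
  have "minimal_generating_set S (atoms S)"
    unfolding minimal_generating_set_def
    using hull_atoms[OF S] atoms_subset_generators by blast
  then show ?thesis
    unfolding msg_def using the1_equality[OF ex1_minimal_generating_set[OF S]] by blast
qed

lemma add_submonoid_mult:
  assumes "add_submonoid S" and "m \<in> S"
  shows "k * m \<in> S"
  using assms by (induction k) (auto simp: add_submonoid_def)

text \<open>Of two distinct nonzero elements of \<open>S\<close> congruent modulo \<open>m\<close>, the larger is the
  smaller plus a multiple of \<open>m\<close>, so
  it is no atom.\<close>

lemma inj_on_atoms_mod:
  assumes S: "add_submonoid S" and m: "m \<in> S"
  shows "inj_on (\<lambda>x. x mod m) (atoms S)"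
proof -
  have no: False
    if x: "x \<in> atoms S" and y: "y \<in> atoms S" and eq: "x mod m = y mod m" and lt: "x < y"
    for x y
  proof -
    have "m dvd y - x" using eq lt mod_eq_dvd_iff_nat[of x y m] by simp
    then obtain k where "y - x = k * m" by (metis dvd_def mult.commute)
    then have d: "y - x \<in> S" using add_submonoid_mult[OF S m] by simp
    have "x \<in> S" "x \<noteq> 0" using x by (auto simp: atoms_def)
    moreover have "\<forall>a\<in>S. \<forall>b\<in>S. a \<noteq> 0 \<longrightarrow> b \<noteq> 0 \<longrightarrow> y \<noteq> a + b"
      using y unfolding atoms_def by blast
    moreover have "y - x \<noteq> 0" using lt by simp
    ultimately have "y \<noteq> x + (y - x)" using d by blast
    then show False using lt by simp
  qed
  show ?thesis
  proof (rule inj_onI)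
    fix x y assume xy: "x \<in> atoms S" "y \<in> atoms S" "x mod m = y mod m"
    show "x = y"
    proof (rule linorder_cases[of x y])
      assume "x < y"
      then show ?thesis using no[OF xy] by blast
    next
      assume "y < x"
      then show ?thesis using no[OF xy(2,1) xy(3)[symmetric]] by blast
    qed
  qed
qed

lemma
  assumes S: "add_submonoid S" and m: "m \<in> S" "0 < m"
  shows finite_atoms: "finite (atoms S)" and card_atoms_le: "card (atoms S) \<le> m"
proof -
  have inj: "inj_on (\<lambda>x. x mod m) (atoms S)" by (rule inj_on_atoms_mod[OF S m(1)])
  have sub: "(\<lambda>x. x mod m) ` atoms S \<subseteq> {..<m}" using m(2) by auto
  show "finite (atoms S)" using inj sub by (meson finite_lessThan inj_on_finite)
  show "card (atoms S) \<le> m" using card_inj_on_le[OF inj sub] by simp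
qed

section \<open>Semigroups of given Frobenius number and multiplicity\<close>

lemma frobenius_number_eq_iff:
  assumes "finite (UNIV - S)"
  shows "frobenius_number S = int F \<longleftrightarrow> F \<notin> S \<and> (\<forall>x>F. x \<in> S)"
proof
  assume F: "frobenius_number S = int F"
  \<comment> \<open>The greatest integer gap lies in this finite set: \<open>-1\<close> bounds all negative integers,
    which are gaps as well.\<close>
  let ?G = "insert (-1) (int ` (UNIV - S))"
  have fin: "finite ?G" using assms by simp
  have in_gaps: "z \<in> ?G" if z: "z \<notin> int ` S" and "0 \<le> z" for z
  proof -
    obtain n where n: "z = int n" using \<open>0 \<le> z\<close> by (rule nonneg_int_cases)
    then have "n \<in> UNIV - S" using z by blast
    then show ?thesis unfolding n by (rule insertI2[OF imageI])
  qed
  have mem: "Max ?G \<notin> int ` S" using Max_in[OF fin] by auto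
  have max: "z \<le> Max ?G" if z: "z \<notin> int ` S" for z
  proof (cases "0 \<le> z")
    case True
    then show ?thesis using in_gaps[OF z] Max_ge[OF fin] by blast
  next
    case False
    moreover have "-1 \<le> Max ?G" using Max_ge[OF fin] by blast
    ultimately show ?thesis by linarith
  qed
  have "frobenius_number S = Max ?G"
    unfolding frobenius_number_def using mem max by (rule Greatest_equality)
  with F mem max have F_gap: "int F \<notin> int ` S" and F_max: "\<And>z. z \<notin> int ` S \<Longrightarrow> z \<le> int F"
    by auto
  have "x \<in> S" if "F < x" for x
  proof (rule ccontr)
    assume "x \<notin> S"
    then have "int x \<notin> int ` S" by auto
    then show False using F_max[of "int x"] that by simp
  qed
  then show "F \<notin> S \<and> (\<forall>x>F. x \<in> S)" using F_gap by auto
next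
  assume F: "F \<notin> S \<and> (\<forall>x>F. x \<in> S)"
  show "frobenius_number S = int F"
    unfolding frobenius_number_def
  proof (rule Greatest_equality)
    show "int F \<notin> int ` S" using F by auto
    fix z assume z: "z \<notin> int ` S"
    show "z \<le> int F"
    proof (rule ccontr)
      assume "\<not> z \<le> int F"
      then have "z = int (nat z)" "nat z > F" by auto
      then show False using F z by (metis imageI)
    qed
  qed
qed

lemma semigroup_multiplicity_eq_iff:
  assumes "\<exists>x\<in>S. x \<noteq> 0"
  shows "semigroup_multiplicity S = m \<longleftrightarrow> m \<in> S \<and> 0 < m \<and> (\<forall>x\<in>S. x \<noteq> 0 \<longrightarrow> m \<le> x)"
proof
  assume m: "semigroup_multiplicity S = m"
  have "\<exists>x. x \<in> S - {0}" using assms by blast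
  then have "m \<in> S - {0}" using m unfolding semigroup_multiplicity_def by (metis (mono_tags) LeastI_ex)
  moreover have "m \<le> x" if "x \<in> S - {0}" for x
    using m that unfolding semigroup_multiplicity_def by (metis (mono_tags) Least_le)
  ultimately show "m \<in> S \<and> 0 < m \<and> (\<forall>x\<in>S. x \<noteq> 0 \<longrightarrow> m \<le> x)" by auto
next
  assume "m \<in> S \<and> 0 < m \<and> (\<forall>x\<in>S. x \<noteq> 0 \<longrightarrow> m \<le> x)"
  then show "semigroup_multiplicity S = m"
    unfolding semigroup_multiplicity_def by (intro Least_equality) auto
qed

lemma RFm_iff:
  "S \<in> RFm F m \<longleftrightarrow> add_submonoid S \<and> F \<notin> S \<and> (\<forall>x>F. x \<in> S) \<and>
     m \<in> S \<and> 0 < m \<and> (\<forall>x\<in>S. x \<noteq> 0 \<longrightarrow> m \<le> x)"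
proof (cases "\<forall>x>F. x \<in> S")
  case True
  then have "UNIV - S \<subseteq> {..F}" using not_less by blast
  then have fin: "finite (UNIV - S)" by (rule finite_subset) simp
  have "Suc F \<in> S" using True by simp
  then have nz: "\<exists>x\<in>S. x \<noteq> 0" by blast
  show ?thesis
    unfolding RFm_def numerical_semigroup_def
    using fin frobenius_number_eq_iff[OF fin] semigroup_multiplicity_eq_iff[OF nz] by auto
next
  case False
  then show ?thesis
    unfolding RFm_def numerical_semigroup_def using frobenius_number_eq_iff[of S F] by auto
qed

lemma Delta_subset:
  assumes "S \<in> RFm F m"
  shows "Delta F m \<subseteq> S"
proof
  fix n assume "n \<in> Delta F m"
  then consider "m dvd n" | "n > F" by (auto simp: Delta_def)
  then show "n \<in> S"
  proof cases
    case 1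
    then have "n = n div m * m" by simp
    then show ?thesis using assms add_submonoid_mult[of S m "n div m"] by (simp add: RFm_iff)
  next
    case 2
    then show ?thesis using assms by (simp add: RFm_iff)
  qed
qed

section \<open>The rank as a number of atoms\<close>

text \<open>The hull lies between \<open>Delta F m\<close> and a member of \<open>RFm F m\<close>. The lower bound supplies
  \<open>m\<close> and all integers above \<open>F\<close>; the upper bound excludes \<open>F\<close> and the positive integers below
  \<open>m\<close>. So the hull is itself a member.\<close>

lemma RFm_generated_eq_hull:
  assumes "RFm_set F m X"
  shows "RFm_generated F m X = add_submonoid hull (X \<union> Delta F m)"
proof -
  let ?H = "add_submonoid hull (X \<union> Delta F m)"
  have lower: "?H \<subseteq> T" if "T \<in> RFm F m" "X \<subseteq> T" for T
    using that Delta_subset[of T F m] by (intro hull_minimal) (auto simp: RFm_iff)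
  obtain T where T: "T \<in> RFm F m" "X \<subseteq> T" using assms by (auto simp: RFm_set_def)
  have sub: "X \<union> Delta F m \<subseteq> ?H" by (rule hull_subset)
  then have "m \<in> ?H" "\<forall>x>F. x \<in> ?H" by (auto simp: Delta_def)
  then have "?H \<in> RFm F m"
    using lower[OF T] T(1) add_submonoid_hull by (auto simp: RFm_iff)
  then show ?thesis
    using lower sub unfolding RFm_generated_def by blast
qed

theorem RFm_rank_eq_card_atoms:
  assumes S: "S \<in> RFm F m"
  shows "RFm_rank F m S = card (atoms S - Delta F m)"
  unfolding RFm_rank_def
proof (rule Least_equality)
  let ?X = "atoms S - Delta F m"
  have mon: "add_submonoid S" using S by (simp add: RFm_iff)
  have X: "RFm_set F m ?X" using S by (auto simp: RFm_set_def atoms_def)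
  have "S \<subseteq> add_submonoid hull (?X \<union> Delta F m)"
    using hull_mono[of "atoms S" "?X \<union> Delta F m" add_submonoid] hull_atoms[OF mon] by auto
  moreover have "add_submonoid hull (?X \<union> Delta F m) \<subseteq> S"
    using mon Delta_subset[OF S] by (intro hull_minimal) (auto simp: atoms_def)
  ultimately have "RFm_generated F m ?X = S" by (simp add: RFm_generated_eq_hull[OF X])
  then show "\<exists>X. RFm_set F m X \<and> RFm_generated F m X = S \<and> card X = card ?X"
    using X by blast
next
  fix k assume "\<exists>X. RFm_set F m X \<and> RFm_generated F m X = S \<and> card X = k"
  then obtain X where X: "RFm_set F m X" "RFm_generated F m X = S" "card X = k" by blast
  have "atoms S \<subseteq> X \<union> Delta F m"
    using X by (intro atoms_subset_generators) (simp add: RFm_generated_eq_hull)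
  then have sub: "atoms S - Delta F m \<subseteq> X" by blast
  have "X \<subseteq> {..F}" using X(1) by (fastforce simp: RFm_set_def Delta_def)
  then have "finite X" by (rule finite_subset) simp
  then show "card (atoms S - Delta F m) \<le> k" using card_mono sub X(3) by blast
qed

text \<open>A proper multiple of \<open>m\<close> is decomposable, so \<open>m\<close> is the only atom divisible by \<open>m\<close>;
  since \<open>m \<le> F\<close>, it is the only atom up to \<open>F\<close> not counted by the rank.\<close>

lemma card_atoms_le_Frobenius:
  assumes S: "S \<in> RFm F m" and "m \<le> F"
  shows "card {x \<in> atoms S. x \<le> F} = Suc (RFm_rank F m S)"
proof -
  have mon: "add_submonoid S" and m: "m \<in> S" "0 < m" and least: "\<forall>x\<in>S. x \<noteq> 0 \<longrightarrow> m \<le> x"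
    using S by (auto simp: RFm_iff)
  have m_atom: "m \<in> atoms S" using m least by (fastforce simp: atoms_def)
  have only_m: "x = m" if "x \<in> atoms S" "m dvd x" for x
    using inj_onD[OF inj_on_atoms_mod[OF mon m(1)] _ that(1) m_atom] that(2) by simp
  have "{x \<in> atoms S. x \<le> F} = insert m (atoms S - Delta F m)"
    using m_atom only_m \<open>m \<le> F\<close> by (auto simp: Delta_def)
  moreover have "m \<notin> atoms S - Delta F m" by (simp add: Delta_def)
  ultimately show ?thesis
    using finite_atoms[OF mon m] by (simp add: RFm_rank_eq_card_atoms[OF S])
qed

section \<open>Semigroups of maximal rank\<close>

theorem proposition6p7:
  fixes m F :: nat and S :: "nat set"
  assumes "0 < m" and "0 < F" and "\<not> m dvd F" and "F > 2 * m"
    and "S \<in> RFm F m"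
  shows "MR_semigroup S \<longleftrightarrow>
    (embedding_dimension S = m - 1 \<and> msg S \<subseteq> {1..F}) \<or>
    (embedding_dimension S = m \<and> card {x \<in> msg S. x > F} = 1)"
proof -
  have mon: "add_submonoid S" and m: "m \<in> S" using assms(5) by (auto simp: RFm_iff)
  note msg = msg_eq_atoms[OF mon]
  let ?small = "{x \<in> atoms S. x \<le> F}" and ?large = "{x \<in> atoms S. x > F}"
  have fin: "finite (atoms S)" and le: "card (atoms S) \<le> m"
    using finite_atoms card_atoms_le mon m assms(1) by blast+
  have "atoms S = ?small \<union> ?large" by auto
  moreover have "card (?small \<union> ?large) = card ?small + card ?large"
    using fin by (intro card_Un_disjoint) auto
  ultimately have sum: "card (atoms S) = card ?small + card ?large" by simp
  have "MR_semigroup S \<longleftrightarrow> int (RFm_rank F m S) = int m - 2"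
    using assms(4,5) by (auto simp: MR_semigroup_def RFm_def)
  then have MR: "MR_semigroup S \<longleftrightarrow> Suc (card ?small) = m"
    using card_atoms_le_Frobenius[OF assms(5)] assms(4) by auto
  have pos: "1 \<le> x" if "x \<in> atoms S" for x
    using that by (simp add: atoms_def)
  have "atoms S \<subseteq> {1..F} \<longleftrightarrow> (\<forall>x\<in>atoms S. \<not> F < x)"
    using pos by (auto simp: subset_iff Ball_def not_less)
  also have "\<dots> \<longleftrightarrow> ?large = {}" by blast
  finally have "atoms S \<subseteq> {1..F} \<longleftrightarrow> ?large = {}" .
  then have none: "atoms S \<subseteq> {1..F} \<longleftrightarrow> card ?large = 0" using fin by simp
  show ?thesis
    unfolding embedding_dimension_def msg MR none using sum le assms(1) by arith
qed

end
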